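(* Let $\Omega\subset\mathbb{C}$ be a domain, let $u_0,\dots,u_N:\Omega\to\mathbb{R}$ be a smooth solution of the periodic 2D-Toda lattice, let $|\lambda|=1$ be fixed, and suppose that for some $m\ge 1$ the $m$-th flow of the hierarchy is trivial, so that $\partial L_m=[L_m,A_\lambda]$ and $\overline{\partial}L_m=[L_m,B_\lambda]$. Let $$X=i\,(L_m+L_m^{\dagger})\in\mathfrak{su}(N+1).$$ Then $\partial\,\mathrm{tr}(X^k)=\overline{\partial}\,\mathrm{tr}(X^k)=0$ on $\Omega$ for every integer $k\ge 2$. In particular, the surface $X:\Omega\to\mathfrak{su}(N+1)\cong\mathbb{R}^{(N+1)^2-1}$ is mapped into a hypersphere of the Euclidean space $\mathfrak{su}(N+1)$ equipped with the inner product $(Y,Z)=-\tfrac12\mathrm{tr}(YZ)$.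
   Context: Notation: $\partial=\partial_\xi$, $\overline{\partial}=\partial_{\overline{\xi}}$, $\xi\in\Omega$; $\dagger$ is the Hermitian conjugate. Matrices are $(N+1)\times(N+1)$, with rows and columns indexed by $0,\dots,N$. For real-valued functions $u_0,\dots,u_N$ with $\sum_i u_i=0$ put $U_{i,j}=e^{u_i-u_j}$. For $\lambda\in\mathbb{C}\setminus\{0\}$ let $A_\lambda$ be the matrix with diagonal entries $\partial u_0,\dots,\partial u_N$, subdiagonal entries $(A_\lambda)_{j,j-1}=U_{j,j-1}$ ($j=1,\dots,N$), upper right corner entry $(A_\lambda)_{0,N}=\lambda U_{0,N}$, and all other entries $0$. Let $\rho(\sum_i X_i\lambda^i)=\sum_i X_i^{\dagger}\lambda^{-i}$ and $B_\lambda=-\rho(A_\lambda)$; for $|\lambda|=1$ this means $B_\lambda=-A_\lambda^{\dagger}$. The periodic 2D-Toda lattice is the equation $\overline{\partial}A_\lambda-\partial B_\lambda=[A_\lambda,B_\lambda]$. Let $\Lambda$ be the matrix with $1$'s on the subdiagonal, $\lambda$ in the upper right corner, and zeros elsewhere. The dressing matrix $T_\infty=D_0+D_1\Lambda^{-1}+D_2\Lambda^{-2}+\cdots$ ($D_i$ diagonal, $D_0$ invertible) is a formal series with $T_\infty(\partial+\Lambda)T_\infty^{-1}=\partial+A_\lambda$ and $\overline{\partial}T_\infty=-B_\lambda T_\infty$. Set $L_m=(T_\infty\Lambda^mT_\infty^{-1})_+$, where $(\cdot)_+$ is the part polynomial in $\Lambda$ (with diagonal coefficients). The $m$-th flow is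 $\partial_{t_m}A_\lambda-\partial L_m=[A_\lambda,L_m]$, $\partial_{t_m}B_\lambda-\overline{\partial}L_m=[B_\lambda,L_m]$; it is trivial when $\partial_{t_m}A_\lambda=\partial_{t_m}B_\lambda=0$. As in the paper, $X$ is taken to be $\mathfrak{su}(N+1)$-valued, where $\mathfrak{su}(N+1)$ is the space of traceless anti-Hermitian matrices. *)

theory Defs
  imports "HOL-Analysis.Derivative" "Jordan_Normal_Form.Schur_Decomposition"
begin

section \<open>Calculus on planar domains\<close>

text \<open>\<^term>\<open>cdiff_on n S f\<close> for all n means real (not complex) smoothness of f on S.\<close>

primrec cdiff_on :: "nat \<Rightarrow> complex set \<Rightarrow> (complex \<Rightarrow> 'a::real_normed_vector) \<Rightarrow> bool" where
  "cdiff_on 0 S f \<longleftrightarrow> continuous_on S f"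
| "cdiff_on (Suc n) S f \<longleftrightarrow> (\<forall>x\<in>S. f differentiable (at x)) \<and>
     (\<forall>v. cdiff_on n S (\<lambda>x. frechet_derivative f (at x) v))"

definition smooth_on :: "complex set \<Rightarrow> (complex \<Rightarrow> 'a::real_normed_vector) \<Rightarrow> bool" where
  "smooth_on S f \<longleftrightarrow> (\<forall>n. cdiff_on n S f)"

definition wirt :: "(complex \<Rightarrow> complex) \<Rightarrow> complex \<Rightarrow> complex" where
  "wirt f \<xi> = (frechet_derivative f (at \<xi>) 1 - \<i> * frechet_derivative f (at \<xi>) \<i>) / 2"

definition wirt_bar :: "(complex \<Rightarrow> complex) \<Rightarrow> complex \<Rightarrow> complex" where
  "wirt_bar f \<xi> = (frechet_derivative f (at \<xi>) 1 + \<i> * frechet_derivative f (at \<xi>) \<i>) / 2"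

definition mat_wirt :: "(complex \<Rightarrow> complex mat) \<Rightarrow> complex \<Rightarrow> complex mat" where
  "mat_wirt F \<xi> = Matrix.mat (dim_row (F \<xi>)) (dim_col (F \<xi>)) (\<lambda>(i,j). wirt (\<lambda>z. F z $$ (i,j)) \<xi>)"

definition mat_wirt_bar :: "(complex \<Rightarrow> complex mat) \<Rightarrow> complex \<Rightarrow> complex mat" where
  "mat_wirt_bar F \<xi> = Matrix.mat (dim_row (F \<xi>)) (dim_col (F \<xi>)) (\<lambda>(i,j). wirt_bar (\<lambda>z. F z $$ (i,j)) \<xi>)"


section \<open>The Euclidean space su(n)\<close>

definition mat_trace :: "complex mat \<Rightarrow> complex" where
  "mat_trace A = (\<Sum>i<dim_row A. A $$ (i,i))"

definition su :: "nat \<Rightarrow> complex mat set" where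
  "su n = {Y \<in> carrier_mat n n. mat_adjoint Y = - Y \<and> mat_trace Y = 0}"

text \<open>The form is complex valued by its type; its values on su(n) are real.\<close>

definition su_inner :: "complex mat \<Rightarrow> complex mat \<Rightarrow> complex" where
  "su_inner Y Z = - (1/2) * mat_trace (Y * Z)"

definition su_sphere :: "nat \<Rightarrow> complex mat \<Rightarrow> real \<Rightarrow> complex mat set" where
  "su_sphere n C r = {Y \<in> su n. su_inner (Y - C) (Y - C) = complex_of_real (r\<^sup>2)}"


section \<open>The periodic 2D-Toda lattice\<close>

definition commutator :: "complex mat \<Rightarrow> complex mat \<Rightarrow> complex mat" where
  "commutator A B = A * B - B * A"

definition toda_U :: "(nat \<Rightarrow> complex \<Rightarrow> real) \<Rightarrow> nat \<Rightarrow> nat \<Rightarrow> complex \<Rightarrow> complex" where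
  "toda_U u i j \<xi> = complex_of_real (exp (u i \<xi> - u j \<xi>))"

definition toda_du :: "(nat \<Rightarrow> complex \<Rightarrow> real) \<Rightarrow> nat \<Rightarrow> complex \<Rightarrow> complex" where
  "toda_du u j \<xi> = wirt (\<lambda>z. complex_of_real (u j z)) \<xi>"

definition toda_A :: "nat \<Rightarrow> (nat \<Rightarrow> complex \<Rightarrow> real) \<Rightarrow> complex \<Rightarrow> complex \<Rightarrow> complex mat" where
  "toda_A N u lam \<xi> = Matrix.mat (N+1) (N+1) (\<lambda>(i,j).
     if i = j then toda_du u i \<xi>
     else if i = j + 1 then toda_U u i j \<xi>
     else if i = 0 \<and> j = N then lam * toda_U u 0 N \<xi>
     else 0)"

text \<open>
  A Laurent polynomial in \<open>\<lambda>\<close> with matrix coefficients is represented by the function of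
  \<open>\<lambda>\<close> that it defines; \<open>rho_laurent\<close> below shows that \<open>rho\<close> replaces
  \<open>X\<^sub>k \<lambda>\<^sup>k\<close> by the adjoint of \<open>X\<^sub>k\<close> times the power of \<open>\<lambda>\<close> with exponent \<open>-k\<close>.
\<close>

definition rho :: "(complex \<Rightarrow> complex mat) \<Rightarrow> complex \<Rightarrow> complex mat" where
  "rho F lam = mat_adjoint (F (1 / cnj lam))"

definition toda_B :: "nat \<Rightarrow> (nat \<Rightarrow> complex \<Rightarrow> real) \<Rightarrow> complex \<Rightarrow> complex \<Rightarrow> complex mat" where
  "toda_B N u lam \<xi> = - rho (\<lambda>l. toda_A N u l \<xi>) lam"

definition toda_solution :: "nat \<Rightarrow> complex set \<Rightarrow> (nat \<Rightarrow> complex \<Rightarrow> real) \<Rightarrow> bool" where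
  "toda_solution N \<Omega> u \<longleftrightarrow>
     (\<forall>j\<le>N. smooth_on \<Omega> (u j)) \<and>
     (\<forall>\<xi>\<in>\<Omega>. (\<Sum>j\<le>N. u j \<xi>) = 0) \<and>
     (\<forall>lam. lam \<noteq> 0 \<longrightarrow> (\<forall>\<xi>\<in>\<Omega>.
        mat_wirt_bar (toda_A N u lam) \<xi> - mat_wirt (toda_B N u lam) \<xi>
          = commutator (toda_A N u lam \<xi>) (toda_B N u lam \<xi>)))"


section \<open>Formal series in the inverse of Lambda with diagonal coefficients\<close>

text \<open>
  \<open>F :: lser\<close> stands for the sum over \<open>k\<close> of \<open>D\<^sub>k \<Lambda>\<^sup>k\<close>, where \<open>D\<^sub>k\<close> is the
  diagonal matrix with entries \<open>F k 0, \<dots>, F k N\<close>.  Only finitely many positive powers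
  occur.  The product is determined by \<open>\<Lambda> D = D' \<Lambda>\<close> with
  \<open>D'\<close> the diagonal matrix whose entry in row \<open>j\<close> is that of \<open>D\<close> in row \<open>j - 1\<close> modulo \<open>N + 1\<close>.
  The spectral parameter is formal here: \<open>\<Lambda>\<^sup>N\<^sup>+\<^sup>1\<close> is \<open>\<lambda>\<close> times the identity.
\<close>

type_synonym lser = "int \<Rightarrow> nat \<Rightarrow> complex"

definition row_shift :: "nat \<Rightarrow> int \<Rightarrow> nat \<Rightarrow> nat" where
  "row_shift N p j = nat ((int j - p) mod (int N + 1))"

definition lser_carrier :: "nat \<Rightarrow> lser set" where
  "lser_carrier N = {F. (\<exists>d. \<forall>k>d. \<forall>j. F k j = 0) \<and> (\<forall>k. \<forall>j>N. F k j = 0)}"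

definition lser_mult :: "nat \<Rightarrow> lser \<Rightarrow> lser \<Rightarrow> lser" where
  "lser_mult N F G = (\<lambda>k j. \<Sum>p | F p j * G (k - p) (row_shift N p j) \<noteq> 0.
                              F p j * G (k - p) (row_shift N p j))"

definition lser_diag :: "nat \<Rightarrow> int \<Rightarrow> (nat \<Rightarrow> complex) \<Rightarrow> lser" where
  "lser_diag N p D = (\<lambda>k j. if k = p \<and> j \<le> N then D j else 0)"

definition lser_alg :: "nat \<Rightarrow> lser monoid" where
  "lser_alg N = \<lparr>carrier = lser_carrier N, monoid.mult = lser_mult N, one = lser_diag N 0 (\<lambda>_. 1)\<rparr>"

definition lser_Lam :: "nat \<Rightarrow> lser" where
  "lser_Lam N = lser_diag N 1 (\<lambda>_. 1)"

definition lser_add :: "lser \<Rightarrow> lser \<Rightarrow> lser" where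
  "lser_add F G = (\<lambda>k j. F k j + G k j)"

definition lser_uminus :: "lser \<Rightarrow> lser" where
  "lser_uminus F = (\<lambda>k j. - F k j)"

text \<open>\<open>rho\<close> sends \<open>D \<Lambda>\<^sup>k\<close> to \<open>\<Lambda>\<close> to the power \<open>-k\<close> times the conjugate of \<open>D\<close>.\<close>

definition lser_rho :: "nat \<Rightarrow> lser \<Rightarrow> lser" where
  "lser_rho N F = (\<lambda>k j. if j \<le> N then cnj (F (- k) (row_shift N k j)) else 0)"

definition lser_pos :: "lser \<Rightarrow> lser" where
  "lser_pos F = (\<lambda>k j. if k \<ge> 0 then F k j else 0)"

definition lser_wirt :: "(complex \<Rightarrow> lser) \<Rightarrow> complex \<Rightarrow> lser" where
  "lser_wirt F \<xi> = (\<lambda>k j. wirt (\<lambda>z. F z k j) \<xi>)"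

definition lser_wirt_bar :: "(complex \<Rightarrow> lser) \<Rightarrow> complex \<Rightarrow> lser" where
  "lser_wirt_bar F \<xi> = (\<lambda>k j. wirt_bar (\<lambda>z. F z k j) \<xi>)"

definition Lam :: "nat \<Rightarrow> complex \<Rightarrow> complex mat" where
  "Lam N lam = Matrix.mat (N+1) (N+1) (\<lambda>(i,j).
     if i = j + 1 then 1 else if i = 0 \<and> j = N then lam else 0)"

definition Lam_inv :: "nat \<Rightarrow> complex \<Rightarrow> complex mat" where
  "Lam_inv N lam = Matrix.mat (N+1) (N+1) (\<lambda>(i,j).
     if j = i + 1 then 1 else if i = N \<and> j = 0 then 1 / lam else 0)"

definition Lam_pow :: "nat \<Rightarrow> complex \<Rightarrow> int \<Rightarrow> complex mat" where
  "Lam_pow N lam k = (if k \<ge> 0 then Lam N lam ^\<^sub>m nat k else Lam_inv N lam ^\<^sub>m nat (- k))"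

text \<open>The matrix obtained from a series with finitely many nonzero terms by fixing the
  value of the spectral parameter.\<close>

definition lser_eval :: "nat \<Rightarrow> complex \<Rightarrow> lser \<Rightarrow> complex mat" where
  "lser_eval N lam F = Matrix.mat (N+1) (N+1) (\<lambda>(i,j).
     \<Sum>k | \<exists>l. F k l \<noteq> 0. (mat_diag (N+1) (F k) * Lam_pow N lam k) $$ (i,j))"

text \<open>The Lax matrices as elements of this algebra (see \<open>lser_eval_toda_A\<close> and
  \<open>lser_eval_toda_B\<close> below).\<close>

definition lser_toda_A :: "nat \<Rightarrow> (nat \<Rightarrow> complex \<Rightarrow> real) \<Rightarrow> complex \<Rightarrow> lser" where
  "lser_toda_A N u \<xi> = lser_add (lser_diag N 0 (\<lambda>j. toda_du u j \<xi>))
     (lser_diag N 1 (\<lambda>j. if j = 0 then toda_U u 0 N \<xi> else toda_U u j (j - 1) \<xi>))"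

definition lser_toda_B :: "nat \<Rightarrow> (nat \<Rightarrow> complex \<Rightarrow> real) \<Rightarrow> complex \<Rightarrow> lser" where
  "lser_toda_B N u \<xi> = lser_uminus (lser_rho N (lser_toda_A N u \<xi>))"


section \<open>Dressing matrix and flows\<close>

text \<open>The first differential equation is \<open>T (\<partial> + \<Lambda>) T\<^sup>-\<^sup>1 = \<partial> + A\<close> with
  \<open>T \<partial> T\<^sup>-\<^sup>1\<close> (a composition of operators) expanded to \<open>\<partial>\<close> plus \<open>T\<close> times the derivative
  of \<open>T\<^sup>-\<^sup>1\<close>.\<close>

definition dressing :: "nat \<Rightarrow> complex set \<Rightarrow> (nat \<Rightarrow> complex \<Rightarrow> real) \<Rightarrow> (complex \<Rightarrow> lser) \<Rightarrow> bool" where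
  "dressing N \<Omega> u T \<longleftrightarrow>
     (\<forall>\<xi>\<in>\<Omega>. T \<xi> \<in> lser_carrier N \<and> (\<forall>k>0. \<forall>j. T \<xi> k j = 0) \<and> (\<forall>j\<le>N. T \<xi> 0 j \<noteq> 0)) \<and>
     (\<forall>k j. smooth_on \<Omega> (\<lambda>\<xi>. T \<xi> k j)) \<and>
     (\<forall>\<xi>\<in>\<Omega>. lser_add (T \<xi> \<otimes>\<^bsub>lser_alg N\<^esub> lser_wirt (\<lambda>z. inv\<^bsub>lser_alg N\<^esub> (T z)) \<xi>)
                (T \<xi> \<otimes>\<^bsub>lser_alg N\<^esub> lser_Lam N \<otimes>\<^bsub>lser_alg N\<^esub> inv\<^bsub>lser_alg N\<^esub> (T \<xi>))
              = lser_toda_A N u \<xi>) \<and>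
     (\<forall>\<xi>\<in>\<Omega>. lser_wirt_bar T \<xi> = lser_uminus (lser_toda_B N u \<xi>) \<otimes>\<^bsub>lser_alg N\<^esub> T \<xi>)"

definition flow_L :: "nat \<Rightarrow> (complex \<Rightarrow> lser) \<Rightarrow> nat \<Rightarrow> complex \<Rightarrow> complex \<Rightarrow> complex mat" where
  "flow_L N T m lam \<xi> = lser_eval N lam (lser_pos
     (T \<xi> \<otimes>\<^bsub>lser_alg N\<^esub> (lser_Lam N [^]\<^bsub>lser_alg N\<^esub> m) \<otimes>\<^bsub>lser_alg N\<^esub> inv\<^bsub>lser_alg N\<^esub> (T \<xi>)))"

text \<open>The values which the equations of the m-th flow prescribe for the derivatives of
  the Lax matrices with respect to the flow time.\<close>

definition flow_dt_A :: "nat \<Rightarrow> (nat \<Rightarrow> complex \<Rightarrow> real) \<Rightarrow> (complex \<Rightarrow> lser) \<Rightarrow> nat \<Rightarrow> complex \<Rightarrow> complex \<Rightarrow> complex mat" where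
  "flow_dt_A N u T m lam \<xi> =
     mat_wirt (flow_L N T m lam) \<xi> + commutator (toda_A N u lam \<xi>) (flow_L N T m lam \<xi>)"

definition flow_dt_B :: "nat \<Rightarrow> (nat \<Rightarrow> complex \<Rightarrow> real) \<Rightarrow> (complex \<Rightarrow> lser) \<Rightarrow> nat \<Rightarrow> complex \<Rightarrow> complex \<Rightarrow> complex mat" where
  "flow_dt_B N u T m lam \<xi> =
     mat_wirt_bar (flow_L N T m lam) \<xi> + commutator (toda_B N u lam \<xi>) (flow_L N T m lam \<xi>)"

definition flow_trivial :: "nat \<Rightarrow> complex set \<Rightarrow> (nat \<Rightarrow> complex \<Rightarrow> real) \<Rightarrow> (complex \<Rightarrow> lser) \<Rightarrow> nat \<Rightarrow> complex \<Rightarrow> bool" where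
  "flow_trivial N \<Omega> u T m lam \<longleftrightarrow>
     (\<forall>\<xi>\<in>\<Omega>. flow_dt_A N u T m lam \<xi> = 0\<^sub>m (N+1) (N+1) \<and> flow_dt_B N u T m lam \<xi> = 0\<^sub>m (N+1) (N+1))"

definition toda_surface :: "nat \<Rightarrow> (complex \<Rightarrow> lser) \<Rightarrow> nat \<Rightarrow> complex \<Rightarrow> complex \<Rightarrow> complex mat" where
  "toda_surface N T m lam \<xi> = \<i> \<cdot>\<^sub>m (flow_L N T m lam \<xi> + mat_adjoint (flow_L N T m lam \<xi>))"


section \<open>Consistency of the encodings\<close>

lemma mat_adjoint_index:
  fixes A :: "complex mat"
  assumes "i < dim_col A" "j < dim_row A"
  shows "mat_adjoint A $$ (i,j) = cnj (A $$ (j,i))"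
  using assms by (simp add: mat_adjoint_def mat_of_rows_def)

lemma mat_adjoint_dim [simp]:
  "dim_row (mat_adjoint A) = dim_col (A :: complex mat)" "dim_col (mat_adjoint A) = dim_row A"
  by (simp_all add: mat_adjoint_def)

lemma rho_laurent:
  assumes X: "\<And>k. k \<in> K \<Longrightarrow> X k \<in> carrier_mat n n"
    and F: "\<And>l. F l = Matrix.mat n n (\<lambda>(i,j). \<Sum>k\<in>K. X k $$ (i,j) * l powi k)"
    and lam: "lam \<noteq> 0"
  shows "rho F lam = Matrix.mat n n (\<lambda>(i,j). \<Sum>k\<in>K. mat_adjoint (X k) $$ (i,j) * lam powi (- k))"
proof (rule eq_matI)
  fix i j
  assume ij: "i < dim_row (Matrix.mat n n (\<lambda>(i,j). \<Sum>k\<in>K. mat_adjoint (X k) $$ (i,j) * lam powi (- k)))"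
    "j < dim_col (Matrix.mat n n (\<lambda>(i,j). \<Sum>k\<in>K. mat_adjoint (X k) $$ (i,j) * lam powi (- k)))"
  have "mat_adjoint (X k) $$ (i,j) = cnj (X k $$ (j,i))" if "k \<in> K" for k
    using X[OF that] ij by (intro mat_adjoint_index) auto
  moreover have "cnj ((1 / cnj lam) powi k) = lam powi (- k)" for k
    by (auto simp: power_int_def divide_simps)
  ultimately show "rho F lam $$ (i,j) =
      Matrix.mat n n (\<lambda>(i,j). \<Sum>k\<in>K. mat_adjoint (X k) $$ (i,j) * lam powi (- k)) $$ (i,j)"
    using ij by (simp add: rho_def mat_adjoint_index F)
qed (auto simp: rho_def F)

lemma toda_B_unit:
  assumes "cmod lam = 1"
  shows "toda_B N u lam \<xi> = - mat_adjoint (toda_A N u lam \<xi>)"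
proof -
  have "lam * cnj lam = 1"
    using assms complex_norm_square[of lam] by simp
  then have "1 / cnj lam = lam"
    by (metis mult_zero_right nonzero_eq_divide_eq zero_neq_one)
  then show ?thesis
    by (simp only: toda_B_def rho_def)
qed

lemma lser_eval_subset:
  assumes "finite K" "{k. \<exists>l. F k l \<noteq> 0} \<subseteq> K"
  shows "lser_eval N lam F = Matrix.mat (N+1) (N+1) (\<lambda>(i,j).
     \<Sum>k\<in>K. F k i * Lam_pow N lam k $$ (i,j))"
proof -
  have c: "Lam_pow N lam k \<in> carrier_mat (N+1) (N+1)" for k
    by (auto simp: Lam_pow_def Lam_def Lam_inv_def intro!: pow_carrier_mat)
  show ?thesis
    unfolding lser_eval_def
  proof (intro cong_mat refl, clarify)
    fix i j
    assume ij: "i < N + 1" "j < N + 1"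
    have "(\<Sum>k | \<exists>l. F k l \<noteq> 0. (mat_diag (N+1) (F k) * Lam_pow N lam k) $$ (i,j)) =
      (\<Sum>k | \<exists>l. F k l \<noteq> 0. F k i * Lam_pow N lam k $$ (i,j))"
      using ij by (intro sum.cong refl, subst mat_diag_mult_left[OF c]) simp
    also have "\<dots> = (\<Sum>k\<in>K. F k i * Lam_pow N lam k $$ (i,j))"
      using assms by (intro sum.mono_neutral_left) auto
    finally show "(\<Sum>k | \<exists>l. F k l \<noteq> 0. (mat_diag (N+1) (F k) * Lam_pow N lam k) $$ (i,j)) =
      (\<Sum>k\<in>K. F k i * Lam_pow N lam k $$ (i,j))" .
  qed
qed

lemma Lam_pow_simps:
  "Lam_pow N lam 0 = 1\<^sub>m (N+1)" "Lam_pow N lam 1 = Lam N lam" "Lam_pow N lam (- 1) = Lam_inv N lam"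
proof -
  have c: "Lam N lam \<in> carrier_mat (N+1) (N+1)" "Lam_inv N lam \<in> carrier_mat (N+1) (N+1)"
    by (simp_all add: Lam_def Lam_inv_def)
  show "Lam_pow N lam 0 = 1\<^sub>m (N+1)"
    using c by (simp add: Lam_pow_def Lam_def)
  show "Lam_pow N lam 1 = Lam N lam" "Lam_pow N lam (- 1) = Lam_inv N lam"
    using c by (simp_all add: Lam_pow_def)
qed

lemma Lam_inv_right:
  assumes "N \<ge> 1" "lam \<noteq> 0"
  shows "Lam N lam * Lam_inv N lam = 1\<^sub>m (N+1)"
proof (rule eq_matI)
  fix i j
  assume "i < dim_row (1\<^sub>m (N+1) :: complex mat)" "j < dim_col (1\<^sub>m (N+1) :: complex mat)"
  then have ij: "i \<le> N" "j \<le> N" by auto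
  define p where "p = (if i = 0 then N else i - 1)"
  have "(Lam N lam * Lam_inv N lam) $$ (i,j) =
      (\<Sum>k\<in>{0..<N+1}. Lam N lam $$ (i,k) * Lam_inv N lam $$ (k,j))"
    using ij by (simp add: Lam_def Lam_inv_def scalar_prod_def)
  also have "\<dots> = (\<Sum>k\<in>{p}. Lam N lam $$ (i,k) * Lam_inv N lam $$ (k,j))"
    using ij by (intro sum.mono_neutral_right) (auto simp: Lam_def p_def split: if_splits)
  also have "\<dots> = 1\<^sub>m (N+1) $$ (i,j)"
    using ij assms by (auto simp: Lam_def Lam_inv_def p_def)
  finally show "(Lam N lam * Lam_inv N lam) $$ (i,j) = 1\<^sub>m (N+1) $$ (i,j)" .
qed (simp_all add: Lam_def Lam_inv_def)

lemma lser_eval_toda_A: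
  assumes "N \<ge> 1"
  shows "lser_eval N lam (lser_toda_A N u \<xi>) = toda_A N u lam \<xi>"
proof -
  have "{k. \<exists>l. lser_toda_A N u \<xi> k l \<noteq> 0} \<subseteq> {0, 1}"
    by (auto simp: lser_toda_A_def lser_add_def lser_diag_def split: if_splits)
  then show ?thesis
    using assms
    by (subst lser_eval_subset[of "{0,1}"])
      (auto simp: Lam_pow_simps toda_A_def Lam_def lser_toda_A_def lser_add_def lser_diag_def
        intro!: cong_mat)
qed

lemma lser_eval_toda_B:
  assumes "N \<ge> 1" "lam \<noteq> 0"
  shows "lser_eval N lam (lser_toda_B N u \<xi>) = toda_B N u lam \<xi>"
proof -
  have sub: "{k. \<exists>l. lser_toda_B N u \<xi> k l \<noteq> 0} \<subseteq> {0, - 1}"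
    by (auto simp: lser_toda_B_def lser_uminus_def lser_rho_def lser_toda_A_def lser_add_def
        lser_diag_def split: if_splits)
  have s0: "row_shift N 0 i = i" if "i \<le> N" for i
    using that by (simp add: row_shift_def)
  have s1: "row_shift N (- 1) i = (if i = N then 0 else i + 1)" if "i \<le> N" for i
    using that by (auto simp: row_shift_def nat_add_distrib add.commute)
  have re: "cnj (toda_U u i j \<xi>) = toda_U u i j \<xi>" for i j
    by (simp add: toda_U_def)
  show ?thesis
  proof (rule eq_matI)
    fix i j
    assume "i < dim_row (toda_B N u lam \<xi>)" "j < dim_col (toda_B N u lam \<xi>)"
    then have ij: "i \<le> N" "j \<le> N"
      by (auto simp: toda_B_def rho_def toda_A_def)
    have "toda_B N u lam \<xi> $$ (i,j) = - cnj (toda_A N u (1 / cnj lam) \<xi> $$ (j,i))"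
      using ij by (simp add: toda_B_def rho_def mat_adjoint_index toda_A_def)
    also have "\<dots> = lser_toda_B N u \<xi> 0 i * 1\<^sub>m (N+1) $$ (i,j)
        + lser_toda_B N u \<xi> (- 1) i * Lam_inv N lam $$ (i,j)"
      using ij assms
      by (auto simp: toda_A_def Lam_inv_def lser_toda_B_def lser_uminus_def lser_rho_def s0 s1
          lser_toda_A_def lser_add_def lser_diag_def re)
    finally show "lser_eval N lam (lser_toda_B N u \<xi>) $$ (i,j) = toda_B N u lam \<xi> $$ (i,j)"
      using ij by (subst lser_eval_subset[OF _ sub]) (simp_all add: Lam_pow_simps)
  qed (simp_all add: toda_B_def rho_def toda_A_def lser_eval_def)
qed

end

theory Submission
  imports Defs
begin

text \<open>
  Write \<open>L\<close> for the flow matrix.  Triviality of the flow says \<open>\<partial>L = [L, A]\<close> and \<open>\<partial>'L = [L, B]\<close>, where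
  \<open>\<partial>'\<close> denotes the derivative in the conjugate variable.  On the unit circle \<open>B = - A\<^sup>\<dagger>\<close>, and taking
  adjoints exchanges \<open>\<partial>\<close> with \<open>\<partial>'\<close> and reverses commutators, so \<open>L\<^sup>\<dagger>\<close> satisfies the same two
  equations, and hence so does \<open>X = \<i>(L + L\<^sup>\<dagger>)\<close> (\<open>lax_at_hermitian_part\<close>).  By the Leibniz rule
  every power of \<open>X\<close> then satisfies \<open>\<partial>(X\<^sup>k) = [X\<^sup>k, A]\<close>, and the trace of a commutator vanishes
  (\<open>lax_at_pow\<close>, \<open>lax_at_trace\<close>).  For \<open>k = 2\<close> this makes the norm of \<open>X\<close> constant on the
  connected domain, which puts the image on a sphere about the origin; if that sphere degenerates to
  a point, any nonzero element of \<open>su(N+1)\<close> is the centre of a genuine sphere through the origin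
  (\<open>subset_su_sphere\<close>).

  The calculation presupposes that the entries of \<open>L\<close> are differentiable in the real sense, and
  this is where the dressing series is used.  Each coefficient of \<open>T \<Lambda>\<^sup>m T\<^sup>-\<^sup>1\<close> is a finite sum of
  products of coefficients of \<open>T\<close>, of \<open>\<Lambda>\<^sup>m\<close> and of \<open>T\<^sup>-\<^sup>1\<close>, and the coefficients of the inverse are
  rational in those of \<open>T\<close>, with powers of the nonvanishing leading coefficients as denominators.
  To identify the inverse taken in the algebra with the recursively computed one, the formal series
  are shown to form a monoid (\<open>lser_monoid\<close>, \<open>lser_inv_eq\<close>, \<open>differentiable_flow_L\<close>).
\<close>


section \<open>The algebra of formal series\<close>

lemma row_shift_le [simp]: "row_shift N p j \<le> N"
proof -
  have "(int j - p) mod (int N + 1) < int N + 1"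
    by (intro pos_mod_bound) simp
  then show ?thesis by (simp add: row_shift_def)
qed

lemma row_shift_0: "j \<le> N \<Longrightarrow> row_shift N 0 j = j"
  by (simp add: row_shift_def)

lemma row_shift_row_shift: "row_shift N q (row_shift N p j) = row_shift N (p + q) j"
proof -
  have "int (nat ((int j - p) mod (int N + 1))) = (int j - p) mod (int N + 1)"
    by simp
  then show ?thesis
    by (simp add: row_shift_def mod_diff_left_eq diff_diff_eq)
qed

definition lser_deg_le :: "int \<Rightarrow> lser \<Rightarrow> bool" where
  "lser_deg_le d F \<longleftrightarrow> (\<forall>k>d. \<forall>j. F k j = 0)"

lemma lser_carrier_iff:
  "F \<in> lser_carrier N \<longleftrightarrow> (\<exists>d. lser_deg_le d F) \<and> (\<forall>k. \<forall>j>N. F k j = 0)"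
  by (simp add: lser_carrier_def lser_deg_le_def)

text \<open>The product is defined by a sum over a support that depends on the coefficients.  Degree bounds
  allow any large enough window instead, so that sums can be interchanged, and so that the same
  window serves a whole family of series.\<close>

lemma lser_mult_eq:
  assumes "lser_deg_le d F" "lser_deg_le e G" "a \<le> k - e" "d \<le> b"
  shows "lser_mult N F G k j = (\<Sum>p\<in>{a..b}. F p j * G (k - p) (row_shift N p j))"
proof -
  have "F p j * G (k - p) (row_shift N p j) = 0" if "p \<notin> {a..b}" for p
  proof (cases "p > b")
    case True
    then show ?thesis using assms by (simp add: lser_deg_le_def)
  next
    case False
    then have "k - p > e" using that assms by auto
    then show ?thesis using assms by (simp add: lser_deg_le_def)
  qed
  then have "{p. F p j * G (k - p) (row_shift N p j) \<noteq> 0} \<subseteq> {a..b}"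
    by blast
  then show ?thesis
    unfolding lser_mult_def by (intro sum.mono_neutral_left) auto
qed

lemma lser_deg_le_mult:
  assumes "lser_deg_le d F" "lser_deg_le e G"
  shows "lser_deg_le (d + e) (lser_mult N F G)"
  unfolding lser_deg_le_def by (auto simp: lser_mult_eq[OF assms order_refl order_refl])

text \<open>Both sides are the sum over \<open>p\<close> and \<open>q\<close> of \<open>F\<^sub>p G\<^sub>q\<^sub>-\<^sub>p H\<^sub>k\<^sub>-\<^sub>q\<close>; the row shifts agree because they
  compose additively.  The windows below are wide enough for all inner products at once.\<close>

lemma lser_mult_assoc:
  assumes F: "lser_deg_le f F" and G: "lser_deg_le g G" and H: "lser_deg_le h H"
  shows "lser_mult N (lser_mult N F G) H = lser_mult N F (lser_mult N G H)"
proof (intro ext)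
  fix k j
  define P where "P = {k - g - h..f}"
  define Q where "Q = {k - h..f + g}"
  have "lser_mult N (lser_mult N F G) H k j
      = (\<Sum>q\<in>Q. lser_mult N F G q j * H (k - q) (row_shift N q j))"
    unfolding Q_def by (rule lser_mult_eq[OF lser_deg_le_mult[OF F G] H]) auto
  also have "\<dots> = (\<Sum>q\<in>Q. \<Sum>p\<in>P.
      F p j * G (q - p) (row_shift N p j) * H (k - q) (row_shift N q j))"
  proof (intro sum.cong refl)
    fix q assume "q \<in> Q"
    then have "lser_mult N F G q j = (\<Sum>p\<in>P. F p j * G (q - p) (row_shift N p j))"
      unfolding P_def Q_def by (intro lser_mult_eq[OF F G]) auto
    then show "lser_mult N F G q j * H (k - q) (row_shift N q j) = (\<Sum>p\<in>P.
      F p j * G (q - p) (row_shift N p j) * H (k - q) (row_shift N q j))"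
      by (simp add: sum_distrib_right)
  qed
  also have "\<dots> = (\<Sum>p\<in>P. \<Sum>q\<in>Q.
      F p j * G (q - p) (row_shift N p j) * H (k - q) (row_shift N q j))"
    by (rule sum.swap)
  also have "\<dots> = (\<Sum>p\<in>P. F p j * lser_mult N G H (k - p) (row_shift N p j))"
  proof (intro sum.cong refl)
    fix p assume p: "p \<in> P"
    have "lser_mult N G H (k - p) (row_shift N p j) = (\<Sum>r\<in>{k - h - p..f + g - p}.
        G r (row_shift N p j) * H (k - p - r) (row_shift N r (row_shift N p j)))"
      using p unfolding P_def by (intro lser_mult_eq[OF G H]) auto
    also have "\<dots> = (\<Sum>q\<in>Q. G (q - p) (row_shift N p j) * H (k - q) (row_shift N q j))"
      unfolding Q_def
      by (rule sum.reindex_bij_witness[of _ "\<lambda>q. q - p" "\<lambda>r. r + p"])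
        (auto simp: row_shift_row_shift algebra_simps)
    finally show "(\<Sum>q\<in>Q. F p j * G (q - p) (row_shift N p j) * H (k - q) (row_shift N q j))
        = F p j * lser_mult N G H (k - p) (row_shift N p j)"
      by (simp add: sum_distrib_left mult.assoc)
  qed
  also have "\<dots> = lser_mult N F (lser_mult N G H) k j"
    unfolding P_def by (rule lser_mult_eq[OF F lser_deg_le_mult[OF G H], symmetric]) auto
  finally show "lser_mult N (lser_mult N F G) H k j = lser_mult N F (lser_mult N G H) k j" .
qed

lemma lser_deg_le_diag: "lser_deg_le p (lser_diag N p D)"
  by (simp add: lser_deg_le_def lser_diag_def)

lemma lser_diag_carrier: "lser_diag N p D \<in> lser_carrier N"
  using lser_deg_le_diag by (auto simp: lser_carrier_iff lser_diag_def)

lemma lser_monoid: "Group.monoid (lser_alg N)"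
proof (rule monoidI)
  fix F G assume "F \<in> carrier (lser_alg N)" "G \<in> carrier (lser_alg N)"
  then obtain d e where *: "lser_deg_le d F" "lser_deg_le e G" "\<And>k j. j > N \<Longrightarrow> F k j = 0"
    by (auto simp: lser_alg_def lser_carrier_iff)
  then have "lser_mult N F G k j = 0" if "j > N" for k j
    using that by (simp add: lser_mult_def)
  then show "F \<otimes>\<^bsub>lser_alg N\<^esub> G \<in> carrier (lser_alg N)"
    using lser_deg_le_mult[OF *(1,2)] by (auto simp: lser_alg_def lser_carrier_iff)
next
  show "\<one>\<^bsub>lser_alg N\<^esub> \<in> carrier (lser_alg N)"
    by (simp add: lser_alg_def lser_diag_carrier)
next
  fix F G H
  assume "F \<in> carrier (lser_alg N)" "G \<in> carrier (lser_alg N)" "H \<in> carrier (lser_alg N)"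
  then show "F \<otimes>\<^bsub>lser_alg N\<^esub> G \<otimes>\<^bsub>lser_alg N\<^esub> H = F \<otimes>\<^bsub>lser_alg N\<^esub> (G \<otimes>\<^bsub>lser_alg N\<^esub> H)"
    by (auto simp: lser_alg_def lser_carrier_iff intro: lser_mult_assoc)
next
  fix F assume "F \<in> carrier (lser_alg N)"
  then obtain d where d: "lser_deg_le d F" and F: "\<And>k j. j > N \<Longrightarrow> F k j = 0"
    by (auto simp: lser_alg_def lser_carrier_iff)
  have "lser_mult N (lser_diag N 0 (\<lambda>_. 1)) F k j = F k j" for k j
  proof -
    have "lser_mult N (lser_diag N 0 (\<lambda>_. 1)) F k j
      = (\<Sum>p\<in>{min 0 (k - d)..0}. lser_diag N 0 (\<lambda>_. 1) p j * F (k - p) (row_shift N p j))"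
      by (rule lser_mult_eq[OF lser_deg_le_diag d]) auto
    also have "\<dots> = (\<Sum>p\<in>{0}. lser_diag N 0 (\<lambda>_. 1) p j * F (k - p) (row_shift N p j))"
      by (rule sum.mono_neutral_right) (auto simp: lser_diag_def)
    also have "\<dots> = F k j"
      using F by (simp add: lser_diag_def row_shift_0)
    finally show ?thesis .
  qed
  then show "\<one>\<^bsub>lser_alg N\<^esub> \<otimes>\<^bsub>lser_alg N\<^esub> F = F"
    by (simp add: lser_alg_def fun_eq_iff)
  have "lser_mult N F (lser_diag N 0 (\<lambda>_. 1)) k j = F k j" for k j
  proof -
    have "lser_mult N F (lser_diag N 0 (\<lambda>_. 1)) k j
      = (\<Sum>p\<in>{k..max k d}. F p j * lser_diag N 0 (\<lambda>_. 1) (k - p) (row_shift N p j))"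
      by (rule lser_mult_eq[OF d lser_deg_le_diag]) auto
    also have "\<dots> = (\<Sum>p\<in>{k}. F p j * lser_diag N 0 (\<lambda>_. 1) (k - p) (row_shift N p j))"
      by (rule sum.mono_neutral_right) (auto simp: lser_diag_def)
    finally show ?thesis
      by (simp add: lser_diag_def)
  qed
  then show "F \<otimes>\<^bsub>lser_alg N\<^esub> \<one>\<^bsub>lser_alg N\<^esub> = F"
    by (simp add: lser_alg_def fun_eq_iff)
qed


section \<open>Inverting a series with invertible leading term\<close>

text \<open>The coefficient of \<open>\<Lambda>\<^sup>-\<^sup>n\<close> in the inverse of a series without positive powers, obtained by
  solving the equation for the coefficient of \<open>\<Lambda>\<^sup>-\<^sup>n\<close> in the product.\<close>

fun lser_inv_coeff :: "nat \<Rightarrow> lser \<Rightarrow> nat \<Rightarrow> nat \<Rightarrow> complex" where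
  "lser_inv_coeff N F n j = ((if n = 0 then 1 else 0) -
     (\<Sum>i=1..n. F (- int i) j * lser_inv_coeff N F (n - i) (row_shift N (- int i) j))) / F 0 j"

declare lser_inv_coeff.simps [simp del]

lemma lser_inv_coeff_0: "lser_inv_coeff N F 0 j = 1 / F 0 j"
  by (subst lser_inv_coeff.simps) simp

definition lser_right_inv :: "nat \<Rightarrow> lser \<Rightarrow> lser" where
  "lser_right_inv N F = (\<lambda>k j. if k \<le> 0 \<and> j \<le> N then lser_inv_coeff N F (nat (- k)) j else 0)"

lemma lser_deg_le_right_inv: "lser_deg_le 0 (lser_right_inv N F)"
  by (simp add: lser_deg_le_def lser_right_inv_def)

lemma lser_right_inv_carrier: "lser_right_inv N F \<in> lser_carrier N"
  using lser_deg_le_right_inv by (auto simp: lser_carrier_iff lser_right_inv_def)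

lemma lser_mult_right_inv:
  assumes F: "F \<in> lser_carrier N" "lser_deg_le 0 F" "\<And>j. j \<le> N \<Longrightarrow> F 0 j \<noteq> 0"
  shows "lser_mult N F (lser_right_inv N F) = lser_diag N 0 (\<lambda>_. 1)"
proof (intro ext)
  fix k j
  let ?R = "lser_right_inv N F"
  have eq: "lser_mult N F ?R k j = (\<Sum>p\<in>{k..0}. F p j * ?R (k - p) (row_shift N p j))"
    by (rule lser_mult_eq[OF F(2) lser_deg_le_right_inv]) auto
  show "lser_mult N F ?R k j = lser_diag N 0 (\<lambda>_. 1) k j"
  proof (cases "j \<le> N \<and> k \<le> 0")
    case False
    then show ?thesis
      using F(1) by (auto simp: eq lser_carrier_iff lser_diag_def)
  next
    case True
    define n where "n = nat (- k)"
    have k: "k = - int n" using True by (simp add: n_def)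
    have nat_eq: "nat (p + int n) = n - nat (- p)" if "p \<le> 0" for p
      using that by arith
    have "lser_mult N F ?R k j
        = (\<Sum>i\<in>{0..n}. F (- int i) j * lser_inv_coeff N F (n - i) (row_shift N (- int i) j))"
      unfolding eq unfolding k
      by (rule sum.reindex_bij_witness[of _ "\<lambda>i. - int i" "\<lambda>p. nat (- p)"])
        (auto simp: lser_right_inv_def nat_eq)
    also have "\<dots> = F 0 j * lser_inv_coeff N F n j
        + (\<Sum>i=1..n. F (- int i) j * lser_inv_coeff N F (n - i) (row_shift N (- int i) j))"
      using True by (simp add: sum.atLeast_Suc_atMost row_shift_0)
    also have "\<dots> = (if n = 0 then 1 else 0)"
      using True F(3) by (simp add: lser_inv_coeff.simps[of N F n j])
    finally show ?thesis
      using True by (simp add: k lser_diag_def)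
  qed
qed

text \<open>The right inverse has a right inverse of its own, which in a monoid must be the original
  series; hence it is two-sided.\<close>

lemma lser_inv_eq:
  assumes F: "F \<in> lser_carrier N" "lser_deg_le 0 F" "\<And>j. j \<le> N \<Longrightarrow> F 0 j \<noteq> 0"
  shows "inv\<^bsub>lser_alg N\<^esub> F = lser_right_inv N F"
proof -
  interpret Group.monoid "lser_alg N" by (rule lser_monoid)
  let ?R = "lser_right_inv N F" and ?S = "lser_right_inv N (lser_right_inv N F)"
  have R0: "?R 0 j \<noteq> 0" if "j \<le> N" for j
    using that F(3) by (simp add: lser_right_inv_def lser_inv_coeff_0)
  have c: "F \<in> carrier (lser_alg N)" "?R \<in> carrier (lser_alg N)" "?S \<in> carrier (lser_alg N)"
    using F(1) by (simp_all add: lser_alg_def lser_right_inv_carrier)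
  have FR: "F \<otimes>\<^bsub>lser_alg N\<^esub> ?R = \<one>\<^bsub>lser_alg N\<^esub>"
    using lser_mult_right_inv[OF F] by (simp add: lser_alg_def)
  have RS: "?R \<otimes>\<^bsub>lser_alg N\<^esub> ?S = \<one>\<^bsub>lser_alg N\<^esub>"
    using lser_mult_right_inv[OF lser_right_inv_carrier lser_deg_le_right_inv R0]
    by (simp add: lser_alg_def)
  have "F = F \<otimes>\<^bsub>lser_alg N\<^esub> (?R \<otimes>\<^bsub>lser_alg N\<^esub> ?S)"
    using c RS by simp
  also have "\<dots> = ?S"
    using c FR by (simp flip: m_assoc)
  finally show ?thesis
    using inv_unique'[OF c(1,2) FR] RS by simp
qed


section \<open>Differentiability of the flow matrices\<close>

lemma smooth_on_imp_differentiable: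
  assumes "smooth_on S f" "x \<in> S"
  shows "f differentiable (at x)"
proof -
  have "cdiff_on (Suc 0) S f"
    using assms(1) unfolding smooth_on_def by blast
  then show ?thesis
    using assms(2) by simp
qed

text \<open>The dressing series is controlled only on the domain, so closed formulas for derived
  quantities hold only there; this transfers differentiability across such formulas.\<close>

lemma differentiable_transform_open:
  assumes "f differentiable (at x)" "open S" "x \<in> S" "\<And>z. z \<in> S \<Longrightarrow> f z = g z"
  shows "g differentiable (at x)"
  using assms has_derivative_transform_within_open unfolding differentiable_def by metis

text \<open>The recursion divides only by leading coefficients, which do not vanish.\<close>

lemma differentiable_lser_inv_coeff:
  assumes "\<And>k j. (\<lambda>z. F z k j) differentiable (at \<xi>)" "\<And>j. j \<le> N \<Longrightarrow> F \<xi> 0 j \<noteq> 0"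
  shows "j \<le> N \<Longrightarrow> (\<lambda>z. lser_inv_coeff N (F z) n j) differentiable (at \<xi>)"
proof (induction n arbitrary: j rule: less_induct)
  case (less n)
  have "(\<lambda>z. ((if n = 0 then 1 else 0) - (\<Sum>i=1..n. F z (- int i) j *
      lser_inv_coeff N (F z) (n - i) (row_shift N (- int i) j))) / F z 0 j) differentiable (at \<xi>)"
    by (intro differentiable_divide differentiable_diff differentiable_const differentiable_sum
        ballI differentiable_mult assms less finite_atLeastAtMost) auto
  then show ?case
    by (simp only: lser_inv_coeff.simps[of N _ n j])
qed

text \<open>The degree bounds have to be uniform over the neighbourhood: then each coefficient of the
  product is a sum with a fixed finite index set.\<close>

lemma differentiable_lser_mult:
  assumes "open S" "\<xi> \<in> S"
    and "\<And>z. z \<in> S \<Longrightarrow> lser_deg_le d (F z)" "\<And>z. z \<in> S \<Longrightarrow> lser_deg_le e (G z)"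
    and "\<And>k j. (\<lambda>z. F z k j) differentiable (at \<xi>)" "\<And>k j. (\<lambda>z. G z k j) differentiable (at \<xi>)"
  shows "(\<lambda>z. lser_mult N (F z) (G z) k j) differentiable (at \<xi>)"
proof (rule differentiable_transform_open[OF _ assms(1,2)])
  show "(\<lambda>z. \<Sum>p\<in>{k - e..d}. F z p j * G z (k - p) (row_shift N p j)) differentiable (at \<xi>)"
    by (intro differentiable_sum ballI differentiable_mult assms) auto
qed (rule lser_mult_eq[OF assms(3,4) order_refl order_refl, symmetric])

lemma flow_L_carrier: "flow_L N T m lam z \<in> carrier_mat (N+1) (N+1)"
  by (simp add: flow_L_def lser_eval_def)

lemma differentiable_flow_L:
  assumes \<Omega>: "open \<Omega>" "\<xi> \<in> \<Omega>" and T: "dressing N \<Omega> u T" and ij: "i < N + 1" "j < N + 1"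
  shows "(\<lambda>z. flow_L N T m lam z $$ (i,j)) differentiable (at \<xi>)"
proof -
  interpret Group.monoid "lser_alg N" by (rule lser_monoid)
  define P where "P = lser_Lam N [^]\<^bsub>lser_alg N\<^esub> m"
  have "P \<in> carrier (lser_alg N)"
    unfolding P_def by (intro nat_pow_closed) (simp add: lser_alg_def lser_Lam_def lser_diag_carrier)
  then obtain d where P: "lser_deg_le d P"
    by (auto simp: lser_alg_def lser_carrier_iff)
  have Tz: "T z \<in> lser_carrier N" "lser_deg_le 0 (T z)" "\<And>j. j \<le> N \<Longrightarrow> T z 0 j \<noteq> 0"
    if "z \<in> \<Omega>" for z
    using T that by (auto simp: dressing_def lser_deg_le_def)
  have dT: "(\<lambda>z. T z k j) differentiable (at \<xi>)" for k j
  proof -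
    have "smooth_on \<Omega> (\<lambda>z. T z k j)"
      using T by (simp add: dressing_def)
    then show ?thesis
      using \<Omega>(2) by (rule smooth_on_imp_differentiable)
  qed
  define R where "R z = lser_right_inv N (T z)" for z
  have dR: "(\<lambda>z. R z k j) differentiable (at \<xi>)" for k j
    using differentiable_lser_inv_coeff[where F = T, OF dT Tz(3)[OF \<Omega>(2)]]
    by (cases "k \<le> 0 \<and> j \<le> N") (auto simp: R_def lser_right_inv_def)
  define H where "H z = lser_mult N (lser_mult N (T z) P) (R z)" for z
  have degTP: "lser_deg_le d (lser_mult N (T z) P)" if "z \<in> \<Omega>" for z
    using lser_deg_le_mult[OF Tz(2)[OF that] P] by simp
  have degH: "lser_deg_le d (H z)" if "z \<in> \<Omega>" for z
    using lser_deg_le_mult[OF degTP[OF that] lser_deg_le_right_inv] by (simp add: H_def R_def)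
  have degR: "lser_deg_le 0 (R z)" for z
    by (simp add: R_def lser_deg_le_right_inv)
  have dTP: "(\<lambda>z. lser_mult N (T z) P k j) differentiable (at \<xi>)" for k j
    by (rule differentiable_lser_mult[OF \<Omega> Tz(2) P dT]) auto
  have dH: "(\<lambda>z. H z k j) differentiable (at \<xi>)" for k j
    unfolding H_def
    by (rule differentiable_lser_mult[OF \<Omega> degTP degR dTP dR])
  show ?thesis
  proof (rule differentiable_transform_open[OF _ \<Omega>])
    show "(\<lambda>z. \<Sum>k\<in>{0..d}. H z k i * Lam_pow N lam k $$ (i,j)) differentiable (at \<xi>)"
      by (intro differentiable_sum ballI differentiable_mult dH) auto
    fix z assume z: "z \<in> \<Omega>"
    have "flow_L N T m lam z = lser_eval N lam (lser_pos (H z))"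
      using lser_inv_eq[OF Tz[OF z]] by (simp add: flow_L_def H_def R_def P_def lser_alg_def)
    also have "\<dots> = Matrix.mat (N+1) (N+1) (\<lambda>(i,j).
        \<Sum>k\<in>{0..d}. lser_pos (H z) k i * Lam_pow N lam k $$ (i,j))"
    proof (rule lser_eval_subset)
      show "{k. \<exists>l. lser_pos (H z) k l \<noteq> 0} \<subseteq> {0..d}"
        using degH[OF z] unfolding lser_pos_def lser_deg_le_def by (auto split: if_splits) (metis not_le)
    qed simp
    finally show "(\<Sum>k\<in>{0..d}. H z k i * Lam_pow N lam k $$ (i,j)) = flow_L N T m lam z $$ (i,j)"
      using ij by (simp add: lser_pos_def)
  qed
qed


section \<open>Wirtinger derivatives\<close>

text \<open>Both Wirtinger derivatives at once: \<open>c = - \<i>\<close> gives \<^const>\<open>wirt\<close> and \<open>c = \<i>\<close> gives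
  \<^const>\<open>wirt_bar\<close>, and complex conjugation of a function conjugates \<open>c\<close>.\<close>

definition wirtinger :: "complex \<Rightarrow> (complex \<Rightarrow> complex) \<Rightarrow> complex \<Rightarrow> complex" where
  "wirtinger c f \<xi> = (frechet_derivative f (at \<xi>) 1 + c * frechet_derivative f (at \<xi>) \<i>) / 2"

lemma wirt_eq: "wirt = wirtinger (- \<i>)" and wirt_bar_eq: "wirt_bar = wirtinger \<i>"
  by (simp_all add: fun_eq_iff wirt_def wirt_bar_def wirtinger_def)

lemma wirtinger_has_derivative:
  "(f has_derivative f') (at \<xi>) \<Longrightarrow> wirtinger c f \<xi> = (f' 1 + c * f' \<i>) / 2"
  using frechet_derivative_at by (metis wirtinger_def)

lemma wirtinger_const [simp]: "wirtinger c (\<lambda>z. a) \<xi> = 0"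
  by (simp add: wirtinger_def)

lemma wirtinger_add:
  assumes "f differentiable (at \<xi>)" "g differentiable (at \<xi>)"
  shows "wirtinger c (\<lambda>z. f z + g z) \<xi> = wirtinger c f \<xi> + wirtinger c g \<xi>"
  unfolding wirtinger_has_derivative[OF has_derivative_add[OF assms[unfolded frechet_derivative_works]]]
  by (simp add: wirtinger_def field_simps)

lemma wirtinger_mult:
  assumes "f differentiable (at \<xi>)" "g differentiable (at \<xi>)"
  shows "wirtinger c (\<lambda>z. f z * g z) \<xi> = wirtinger c f \<xi> * g \<xi> + f \<xi> * wirtinger c g \<xi>"
  unfolding wirtinger_has_derivative[OF has_derivative_mult[OF assms[unfolded frechet_derivative_works]]]
  by (simp add: wirtinger_def field_simps)

lemma wirtinger_sum:
  assumes "\<And>i. i \<in> I \<Longrightarrow> f i differentiable (at \<xi>)"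
  shows "wirtinger c (\<lambda>z. \<Sum>i\<in>I. f i z) \<xi> = (\<Sum>i\<in>I. wirtinger c (f i) \<xi>)"
  using assms
  by (induction I rule: infinite_finite_induct) (auto simp: wirtinger_add)

lemma wirtinger_cnj:
  assumes "f differentiable (at \<xi>)"
  shows "wirtinger c (\<lambda>z. cnj (f z)) \<xi> = cnj (wirtinger (cnj c) f \<xi>)"
  unfolding wirtinger_has_derivative[OF has_derivative_cnj[OF assms[unfolded frechet_derivative_works]]]
  by (simp add: wirtinger_def)

text \<open>A real-linear map of the plane is determined by its values on \<open>1\<close> and \<open>\<i>\<close>.\<close>

lemma constant_if_wirtinger_0:
  assumes "open S" "connected S"
    and f: "\<And>z. z \<in> S \<Longrightarrow> f differentiable (at z)" "\<And>z. z \<in> S \<Longrightarrow> wirt f z = 0"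
      "\<And>z. z \<in> S \<Longrightarrow> wirt_bar f z = 0"
    and "x \<in> S" "y \<in> S"
  shows "f x = f y"
proof (rule has_derivative_zero_unique_connected[OF assms(1,2) _ assms(6,7)])
  fix z assume z: "z \<in> S"
  let ?D = "frechet_derivative f (at z)"
  have D: "(f has_derivative ?D) (at z)"
    using f(1)[OF z] by (simp add: frechet_derivative_works)
  then interpret D: bounded_linear ?D by (rule has_derivative_bounded_linear)
  have 0: "?D 1 = 0" "?D \<i> = 0"
    using f(2,3)[OF z] by (auto simp: wirt_def wirt_bar_def add_eq_0_iff)
  have "?D h = 0" for h
  proof -
    have "h = Re h *\<^sub>R 1 + Im h *\<^sub>R \<i>"
      by (simp add: complex_eq_iff)
    then have "?D h = ?D (Re h *\<^sub>R 1 + Im h *\<^sub>R \<i>)"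
      by (rule arg_cong)
    also have "\<dots> = 0"
      unfolding D.add D.scaleR by (simp add: 0)
    finally show ?thesis .
  qed
  then have "?D = (\<lambda>h. 0)" by auto
  then show "(f has_derivative (\<lambda>h. 0)) (at z)"
    using D by simp
qed


section \<open>Lax equations\<close>

lemma mult_mat_index:
  fixes A B :: "complex mat"
  assumes "A \<in> carrier_mat n n" "B \<in> carrier_mat n n" "i < n" "j < n"
  shows "(A * B) $$ (i,j) = (\<Sum>l<n. A $$ (i,l) * B $$ (l,j))"
  using assms by (simp add: scalar_prod_def atLeast0LessThan)

lemma commutator_index:
  assumes "A \<in> carrier_mat n n" "B \<in> carrier_mat n n" "i < n" "j < n"
  shows "commutator A B $$ (i,j) = (\<Sum>l<n. A $$ (i,l) * B $$ (l,j) - B $$ (i,l) * A $$ (l,j))"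
  using assms by (simp add: commutator_def mult_mat_index sum_subtractf del: index_mult_mat(1))

lemma commutator_carrier:
  assumes "A \<in> carrier_mat n n" "B \<in> carrier_mat n n"
  shows "commutator A B \<in> carrier_mat n n"
  using assms by (auto simp: commutator_def intro!: minus_carrier_mat mult_carrier_mat)

lemma trace_commutator:
  assumes "A \<in> carrier_mat n n" "B \<in> carrier_mat n n"
  shows "(\<Sum>i<n. commutator A B $$ (i,i)) = 0"
proof -
  have "(\<Sum>i<n. \<Sum>l<n. A $$ (i,l) * B $$ (l,i)) = (\<Sum>i<n. \<Sum>l<n. B $$ (i,l) * A $$ (l,i))"
    by (subst sum.swap) (simp add: mult.commute)
  then show ?thesis
    using assms by (simp add: commutator_index sum_subtractf)
qed

text \<open>The commutator with a fixed matrix is a derivation, which is why Lax equations pass to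
  powers.\<close>

lemma commutator_mult_left:
  assumes "P \<in> carrier_mat n n" "M \<in> carrier_mat n n" "A \<in> carrier_mat n n"
  shows "commutator (P * M) A = commutator P A * M + P * commutator M A"
proof -
  have "commutator P A * M + P * commutator M A
      = (P * (A * M) - A * (P * M)) + (P * (M * A) - P * (A * M))"
    using assms minus_mult_distrib_mat[of "P * A" n n "A * P" M n]
      mult_minus_distrib_mat[of P n n "M * A" n "A * M"]
    by (simp add: commutator_def assoc_mult_mat[of _ n n _ n _ n])
  also have "\<dots> = P * (M * A) - A * (P * M)"
    using assms by (intro eq_matI) auto
  finally show ?thesis
    using assms by (simp add: commutator_def assoc_mult_mat[of _ n n _ n _ n])
qed

text \<open>Differentiability is part of the notion because \<^const>\<open>frechet_derivative\<close> is unspecified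
  where a function has no derivative.\<close>

definition lax_at :: "complex \<Rightarrow> nat \<Rightarrow> complex \<Rightarrow> (complex \<Rightarrow> complex mat) \<Rightarrow> complex mat \<Rightarrow> bool" where
  "lax_at c n \<xi> M A \<longleftrightarrow> (\<forall>i<n. \<forall>j<n. (\<lambda>z. M z $$ (i,j)) differentiable (at \<xi>) \<and>
     wirtinger c (\<lambda>z. M z $$ (i,j)) \<xi> = commutator (M \<xi>) A $$ (i,j))"

lemma lax_at_pow:
  assumes M: "\<And>z. M z \<in> carrier_mat n n" and A: "A \<in> carrier_mat n n" and L: "lax_at c n \<xi> M A"
  shows "lax_at c n \<xi> (\<lambda>z. M z ^\<^sub>m k) A"
proof (induction k)
  case 0
  have "dim_row (M z) = n" for z using M[of z] by simp
  then show ?case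
    using A by (auto simp: lax_at_def commutator_def)
next
  case (Suc k)
  have Mk: "M z ^\<^sub>m k \<in> carrier_mat n n" for z
    using M by (rule pow_carrier_mat)
  show ?case
    unfolding lax_at_def
  proof (intro allI impI)
    fix i j assume ij: "i < n" "j < n"
    have eq: "(\<lambda>z. (M z ^\<^sub>m Suc k) $$ (i,j)) = (\<lambda>z. \<Sum>l<n. (M z ^\<^sub>m k) $$ (i,l) * M z $$ (l,j))"
      unfolding pow_mat.simps using ij by (simp only: mult_mat_index[OF Mk M])
    have d: "(\<lambda>z. (M z ^\<^sub>m k) $$ (i,l)) differentiable (at \<xi>)"
        "(\<lambda>z. M z $$ (l,j)) differentiable (at \<xi>)" if "l < n" for l
      using Suc L ij that by (auto simp: lax_at_def)
    have "wirtinger c (\<lambda>z. (M z ^\<^sub>m Suc k) $$ (i,j)) \<xi>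
        = (\<Sum>l<n. commutator (M \<xi> ^\<^sub>m k) A $$ (i,l) * M \<xi> $$ (l,j)
            + (M \<xi> ^\<^sub>m k) $$ (i,l) * commutator (M \<xi>) A $$ (l,j))"
      unfolding eq using ij Suc L d
      by (subst wirtinger_sum) (auto simp: wirtinger_mult lax_at_def intro!: sum.cong)
    also have "\<dots> = (commutator (M \<xi> ^\<^sub>m k) A * M \<xi> + M \<xi> ^\<^sub>m k * commutator (M \<xi>) A) $$ (i,j)"
    proof -
      have "commutator (M \<xi> ^\<^sub>m k) A \<in> carrier_mat n n" "commutator (M \<xi>) A \<in> carrier_mat n n"
        using Mk M A by (auto intro: commutator_carrier)
      then show ?thesis
        using ij Mk[of \<xi>] M[of \<xi>]
        by (simp add: sum.distrib mult_mat_index[of _ n] del: index_mult_mat(1))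
    qed
    also have "\<dots> = commutator (M \<xi> ^\<^sub>m Suc k) A $$ (i,j)"
      using commutator_mult_left[OF Mk M A] by simp
    finally show "(\<lambda>z. (M z ^\<^sub>m Suc k) $$ (i,j)) differentiable (at \<xi>) \<and>
        wirtinger c (\<lambda>z. (M z ^\<^sub>m Suc k) $$ (i,j)) \<xi> = commutator (M \<xi> ^\<^sub>m Suc k) A $$ (i,j)"
      unfolding eq using d by auto
  qed
qed

lemma lax_at_trace:
  assumes M: "\<And>z. M z \<in> carrier_mat n n" and A: "A \<in> carrier_mat n n" and L: "lax_at c n \<xi> M A"
  shows "(\<lambda>z. mat_trace (M z)) differentiable (at \<xi>)" "wirtinger c (\<lambda>z. mat_trace (M z)) \<xi> = 0"
proof -
  have eq: "(\<lambda>z. mat_trace (M z)) = (\<lambda>z. \<Sum>i<n. M z $$ (i,i))"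
    unfolding mat_trace_def carrier_matD(1)[OF M] ..
  show "(\<lambda>z. mat_trace (M z)) differentiable (at \<xi>)"
    unfolding eq using L by (auto simp: lax_at_def)
  have "wirtinger c (\<lambda>z. mat_trace (M z)) \<xi> = (\<Sum>i<n. commutator (M \<xi>) A $$ (i,i))"
    unfolding eq using L by (subst wirtinger_sum) (auto simp: lax_at_def)
  then show "wirtinger c (\<lambda>z. mat_trace (M z)) \<xi> = 0"
    using trace_commutator[OF M A] by simp
qed

text \<open>Taking adjoints exchanges the two Wirtinger derivatives and turns a commutator with
  \<open>- A\<^sup>\<dagger>\<close> into a commutator with \<open>A\<close>: from \<open>\<partial>'M = [M, - A\<^sup>\<dagger>]\<close> follows \<open>\<partial>(M\<^sup>\<dagger>) = [M\<^sup>\<dagger>, A]\<close>.\<close>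

lemma lax_at_hermitian_part:
  assumes M: "\<And>z. M z \<in> carrier_mat n n" and A: "A \<in> carrier_mat n n"
    and L: "lax_at c n \<xi> M A" "lax_at (cnj c) n \<xi> M (- mat_adjoint A)"
  shows "lax_at c n \<xi> (\<lambda>z. \<i> \<cdot>\<^sub>m (M z + mat_adjoint (M z))) A"
  unfolding lax_at_def
proof (intro allI impI)
  fix i j assume ij: "i < n" "j < n"
  have Md: "dim_row (M z) = n" "dim_col (M z) = n" for z
    using M[of z] by auto
  have Ad: "dim_row A = n" "dim_col A = n"
    using A by auto
  let ?X = "\<lambda>z. \<i> \<cdot>\<^sub>m (M z + mat_adjoint (M z))"
  have X: "?X z $$ (i,j) = \<i> * (M z $$ (i,j) + cnj (M z $$ (j,i)))" if "i < n" "j < n" for z i j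
    using that Md by (simp add: mat_adjoint_index)
  have eq: "(\<lambda>z. ?X z $$ (i,j)) = (\<lambda>z. \<i> * (M z $$ (i,j) + cnj (M z $$ (j,i))))"
    using X ij by blast
  have d: "(\<lambda>z. M z $$ (i,j)) differentiable (at \<xi>)" "(\<lambda>z. M z $$ (j,i)) differentiable (at \<xi>)"
    using L(1) ij by (auto simp: lax_at_def)
  have d': "(\<lambda>z. cnj (M z $$ (j,i))) differentiable (at \<xi>)"
    using d(2) by (simp add: differentiable_cnj_iff)
  have A': "- mat_adjoint A \<in> carrier_mat n n"
    using Ad by (intro carrier_matI) auto
  have Xc: "?X \<xi> \<in> carrier_mat n n"
    using Md by (intro carrier_matI) auto
  have "wirtinger c (\<lambda>z. ?X z $$ (i,j)) \<xi> = \<i> * (wirtinger c (\<lambda>z. M z $$ (i,j)) \<xi>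
      + cnj (wirtinger (cnj c) (\<lambda>z. M z $$ (j,i)) \<xi>))"
    unfolding eq using d d' by (simp add: wirtinger_mult wirtinger_add wirtinger_cnj)
  also have "\<dots> = \<i> * (commutator (M \<xi>) A $$ (i,j)
      + cnj (commutator (M \<xi>) (- mat_adjoint A) $$ (j,i)))"
    using L ij by (simp add: lax_at_def)
  also have "cnj (commutator (M \<xi>) (- mat_adjoint A) $$ (j,i))
      = (\<Sum>l<n. cnj (M \<xi> $$ (l,i)) * A $$ (l,j) - A $$ (i,l) * cnj (M \<xi> $$ (j,l)))"
    using ij Ad by (simp add: commutator_index[OF M A'] mat_adjoint_index algebra_simps)
  also have "\<i> * (commutator (M \<xi>) A $$ (i,j) + \<dots>) = commutator (?X \<xi>) A $$ (i,j)"
    unfolding commutator_index[OF Xc A ij] commutator_index[OF M A ij] sum.distrib[symmetric]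
      sum_distrib_left
    using ij by (intro sum.cong refl) (subst (1 2) X, auto simp: algebra_simps)
  finally show "(\<lambda>z. ?X z $$ (i,j)) differentiable (at \<xi>) \<and>
      wirtinger c (\<lambda>z. ?X z $$ (i,j)) \<xi> = commutator (?X \<xi>) A $$ (i,j)"
    unfolding eq using d d' by simp
qed

lemma add_commutator_eq_0D:
  assumes "A \<in> carrier_mat n n" "M \<in> carrier_mat n n" "D \<in> carrier_mat n n"
    and "D + commutator A M = 0\<^sub>m n n" "i < n" "j < n"
  shows "D $$ (i,j) = commutator M A $$ (i,j)"
proof -
  have "(D + commutator A M) $$ (i,j) = 0"
    using assms by simp
  then show ?thesis
    using assms by (simp add: commutator_def algebra_simps)
qed

text \<open>On the unit circle \<open>A\<close> and \<open>B\<close> are minus the adjoints of each other, so that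
  \<open>lax_at_hermitian_part\<close> applies in both directions.\<close>

lemma lax_at_toda_surface:
  assumes "open \<Omega>" "\<xi> \<in> \<Omega>" "dressing N \<Omega> u T" "cmod lam = 1" "flow_trivial N \<Omega> u T m lam"
  shows "lax_at (- \<i>) (N+1) \<xi> (toda_surface N T m lam) (toda_A N u lam \<xi>)"
    and "lax_at \<i> (N+1) \<xi> (toda_surface N T m lam) (toda_B N u lam \<xi>)"
proof -
  let ?L = "flow_L N T m lam" and ?A = "toda_A N u lam \<xi>" and ?B = "toda_B N u lam \<xi>"
  have A: "?A \<in> carrier_mat (N+1) (N+1)"
    by (simp add: toda_A_def)
  have B_eq: "?B = - mat_adjoint ?A"
    using assms(4) by (rule toda_B_unit)
  then have B: "?B \<in> carrier_mat (N+1) (N+1)"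
    using A by (intro carrier_matI) auto
  have A_eq: "?A = - mat_adjoint ?B"
    using A unfolding B_eq by (intro eq_matI) (auto simp: mat_adjoint_index)
  have W: "mat_wirt ?L \<xi> \<in> carrier_mat (N+1) (N+1)" "mat_wirt_bar ?L \<xi> \<in> carrier_mat (N+1) (N+1)"
    using flow_L_carrier[of N T m lam \<xi>] by (simp_all add: mat_wirt_def mat_wirt_bar_def)
  have F: "mat_wirt ?L \<xi> + commutator ?A (?L \<xi>) = 0\<^sub>m (N+1) (N+1)"
      "mat_wirt_bar ?L \<xi> + commutator ?B (?L \<xi>) = 0\<^sub>m (N+1) (N+1)"
    using assms(2,5) by (simp_all add: flow_trivial_def flow_dt_A_def flow_dt_B_def)
  have LA: "lax_at (- \<i>) (N+1) \<xi> ?L ?A"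
    using differentiable_flow_L[OF assms(1-3)] flow_L_carrier[of N T m lam \<xi>]
      add_commutator_eq_0D[OF A flow_L_carrier W(1) F(1)]
    by (simp add: lax_at_def mat_wirt_def wirt_eq)
  have LB: "lax_at \<i> (N+1) \<xi> ?L ?B"
    using differentiable_flow_L[OF assms(1-3)] flow_L_carrier[of N T m lam \<xi>]
      add_commutator_eq_0D[OF B flow_L_carrier W(2) F(2)]
    by (simp add: lax_at_def mat_wirt_bar_def wirt_bar_eq)
  have S: "toda_surface N T m lam = (\<lambda>z. \<i> \<cdot>\<^sub>m (?L z + mat_adjoint (?L z)))"
    by (simp add: toda_surface_def fun_eq_iff)
  show "lax_at (- \<i>) (N+1) \<xi> (toda_surface N T m lam) ?A"
    unfolding S using LA LB B_eq by (intro lax_at_hermitian_part flow_L_carrier A) simp_all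
  show "lax_at \<i> (N+1) \<xi> (toda_surface N T m lam) ?B"
    unfolding S using LA LB A_eq by (intro lax_at_hermitian_part flow_L_carrier B) simp_all
qed


section \<open>The Euclidean geometry of su(n)\<close>

text \<open>For anti-Hermitian \<open>Y\<close> one has \<open>- Y\<^sup>2 = Y Y\<^sup>\<dagger>\<close>, so the form is half the squared Frobenius
  norm: it is real and vanishes only at the origin.\<close>

lemma su_inner_self:
  assumes "Y \<in> su n"
  shows "su_inner Y Y = complex_of_real ((\<Sum>i<n. \<Sum>l<n. (cmod (Y $$ (i,l)))\<^sup>2) / 2)"
proof -
  have Y: "Y \<in> carrier_mat n n" and adj: "mat_adjoint Y = - Y"
    using assms by (auto simp: su_def)
  have c: "Y $$ (l,i) = - cnj (Y $$ (i,l))" if "i < n" "l < n" for i l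
    using arg_cong[OF adj, of "\<lambda>Z. Z $$ (l,i)"] Y that by (simp add: mat_adjoint_index)
  have "mat_trace (Y * Y) = (\<Sum>i<n. \<Sum>l<n. Y $$ (i,l) * Y $$ (l,i))"
    using Y by (simp add: mat_trace_def mult_mat_index[OF Y Y] del: index_mult_mat(1))
  also have "\<dots> = (\<Sum>i<n. \<Sum>l<n. - complex_of_real ((cmod (Y $$ (i,l)))\<^sup>2))"
    by (intro sum.cong refl, subst c) (auto simp: complex_norm_square simp del: of_real_power)
  finally show ?thesis
    by (simp add: su_inner_def sum_negf)
qed

lemma su_sphere_0_iff:
  "Y \<in> su_sphere n (0\<^sub>m n n) r \<longleftrightarrow> Y \<in> su n \<and> su_inner Y Y = complex_of_real (r\<^sup>2)"
proof (cases "Y \<in> su n")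
  case True
  then have "Y - 0\<^sub>m n n = Y"
    by (intro eq_matI) (auto simp: su_def)
  then show ?thesis by (simp add: su_sphere_def)
qed (simp add: su_sphere_def)

lemma zero_in_su: "0\<^sub>m n n \<in> su n"
  by (auto simp: su_def mat_trace_def mat_adjoint_index intro!: eq_matI)

lemma ex_nonzero_su:
  assumes "n \<ge> 2"
  obtains C where "C \<in> su n" "(\<Sum>i<n. \<Sum>l<n. (cmod (C $$ (i,l)))\<^sup>2) > 0"
proof
  define C :: "complex mat" where
    "C = Matrix.mat n n (\<lambda>(i,j). if i = 0 \<and> j = 1 then 1 else if i = 1 \<and> j = 0 then - 1 else 0)"
  show "C \<in> su n"
    by (auto simp: su_def C_def mat_trace_def mat_adjoint_index intro!: eq_matI sum.neutral)
  have "0 < (cmod (C $$ (0,1)))\<^sup>2"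
    using assms by (simp add: C_def)
  also have "\<dots> \<le> (\<Sum>l<n. (cmod (C $$ (0,l)))\<^sup>2)"
    using assms by (intro member_le_sum[of 1 _ "\<lambda>l. (cmod (C $$ (0,l)))\<^sup>2"]) auto
  also have "\<dots> \<le> (\<Sum>i<n. \<Sum>l<n. (cmod (C $$ (i,l)))\<^sup>2)"
    using assms
    by (intro member_le_sum[of 0 _ "\<lambda>i. \<Sum>l<n. (cmod (C $$ (i,l)))\<^sup>2"]) (auto intro: sum_nonneg)
  finally show "(\<Sum>i<n. \<Sum>l<n. (cmod (C $$ (i,l)))\<^sup>2) > 0" .
qed

text \<open>The sphere about the origin whose radius is the common norm contains the set.  When that radius
  is zero, the set is at most the origin, and the origin lies on the sphere about any nonzero \<open>C\<close>
  with radius the norm of \<open>C\<close>.\<close>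

lemma subset_su_sphere:
  assumes "n \<ge> 2" and S: "S \<subseteq> su n" and const: "\<And>Y Z. Y \<in> S \<Longrightarrow> Z \<in> S \<Longrightarrow> su_inner Y Y = su_inner Z Z"
  shows "\<exists>r\<ge>0. S \<subseteq> su_sphere n (0\<^sub>m n n) r" "\<exists>C\<in>su n. \<exists>r>0. S \<subseteq> su_sphere n C r"
proof -
  define q where "q Y = (\<Sum>i<n. \<Sum>l<n. (cmod (Y $$ (i,l)))\<^sup>2) / 2" for Y :: "complex mat"
  have q0: "q Y \<ge> 0" for Y
    by (auto simp: q_def intro!: sum_nonneg divide_nonneg_pos)
  have q: "su_inner Y Y = complex_of_real (q Y)" if "Y \<in> su n" for Y
    using su_inner_self[OF that] by (simp add: q_def)
  obtain a where a: "a \<ge> 0" "\<And>Y. Y \<in> S \<Longrightarrow> q Y = a"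
  proof (cases "S = {}")
    case False
    then obtain Y where Y: "Y \<in> S" by auto
    have "q Z = q Y" if "Z \<in> S" for Z
    proof -
      have "Y \<in> su n" "Z \<in> su n" using S Y that by auto
      then have "complex_of_real (q Z) = complex_of_real (q Y)"
        using const[OF that Y] q by simp
      then show ?thesis by simp
    qed
    then show ?thesis using that[of "q Y"] q0 by blast
  qed (use that[of 0] in auto)
  have sub: "S \<subseteq> su_sphere n (0\<^sub>m n n) (sqrt a)"
    using S a q by (auto simp: su_sphere_0_iff simp flip: of_real_power)
  then show "\<exists>r\<ge>0. S \<subseteq> su_sphere n (0\<^sub>m n n) r"
    using a(1) by (intro exI[of _ "sqrt a"]) simp
  show "\<exists>C\<in>su n. \<exists>r>0. S \<subseteq> su_sphere n C r"
  proof (cases "a = 0")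
    case False
    then show ?thesis
      using sub a(1) zero_in_su by (intro bexI[of _ "0\<^sub>m n n"] exI[of _ "sqrt a"]) auto
  next
    case True
    obtain C where C: "C \<in> su n" "q C > 0"
      using ex_nonzero_su[OF assms(1)] by (auto simp: q_def)
    have "Y \<in> su_sphere n C (sqrt (q C))" if Y: "Y \<in> S" for Y
    proof -
      have "Y \<in> su n" using S Y by auto
      then have Yc: "Y \<in> carrier_mat n n" by (simp add: su_def)
      have Cc: "C \<in> carrier_mat n n" using C(1) by (simp add: su_def)
      have "(\<Sum>i<n. \<Sum>l<n. (cmod (Y $$ (i,l)))\<^sup>2) = 0"
        using a(2)[OF Y] True by (simp add: q_def)
      then have "Y $$ (i,l) = 0" if "i < n" "l < n" for i l
        using that by (simp add: sum_nonneg_eq_0_iff sum_nonneg)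
      then have "Y - C = - C"
        using Yc Cc by (intro eq_matI) auto
      then have "su_inner (Y - C) (Y - C) = su_inner C C"
        using Cc by (simp add: su_inner_def)
      then show ?thesis
        using q[OF C(1)] C(2) \<open>Y \<in> su n\<close> by (simp add: su_sphere_def flip: of_real_power)
    qed
    then show ?thesis
      using C by (intro bexI[of _ C] exI[of _ "sqrt (q C)"]) auto
  qed
qed


section \<open>Toda surfaces lie on spheres\<close>

theorem mainTheorem1:
  fixes N m :: nat
    and \<Omega> :: "complex set"
    and u :: "nat \<Rightarrow> complex \<Rightarrow> real"
    and T :: "complex \<Rightarrow> lser"
    and lam :: complex
  assumes "N \<ge> 1"
    and "open \<Omega>" "connected \<Omega>" "\<Omega> \<noteq> {}"
    and "toda_solution N \<Omega> u"
    and "dressing N \<Omega> u T"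
    and "cmod lam = 1"
    and "m \<ge> 1"
    and "flow_trivial N \<Omega> u T m lam"
    and "\<forall>\<xi>\<in>\<Omega>. toda_surface N T m lam \<xi> \<in> su (N+1)"
  shows "(\<forall>k\<ge>2. \<forall>\<xi>\<in>\<Omega>.
            wirt (\<lambda>z. mat_trace (toda_surface N T m lam z ^\<^sub>m k)) \<xi> = 0 \<and>
            wirt_bar (\<lambda>z. mat_trace (toda_surface N T m lam z ^\<^sub>m k)) \<xi> = 0) \<and>
         (\<exists>r\<ge>0. toda_surface N T m lam ` \<Omega> \<subseteq> su_sphere (N+1) (0\<^sub>m (N+1) (N+1)) r) \<and>
         (\<exists>C\<in>su (N+1). \<exists>r>0. toda_surface N T m lam ` \<Omega> \<subseteq> su_sphere (N+1) C r)"
proof -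
  let ?X = "toda_surface N T m lam"
  have X: "?X z \<in> carrier_mat (N+1) (N+1)" for z
    using flow_L_carrier[of N T m lam z] by (intro carrier_matI) (auto simp: toda_surface_def)
  have Xk: "?X z ^\<^sub>m k \<in> carrier_mat (N+1) (N+1)" for z k
    using X by (rule pow_carrier_mat)
  have A: "toda_A N u lam \<xi> \<in> carrier_mat (N+1) (N+1)" for \<xi>
    by (simp add: toda_A_def)
  have B: "toda_B N u lam \<xi> \<in> carrier_mat (N+1) (N+1)" for \<xi>
    using A[of \<xi>] unfolding toda_B_unit[OF assms(7)] by (intro carrier_matI) auto
  have tr: "(\<lambda>z. mat_trace (?X z ^\<^sub>m k)) differentiable (at \<xi>)"
      "wirt (\<lambda>z. mat_trace (?X z ^\<^sub>m k)) \<xi> = 0"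
      "wirt_bar (\<lambda>z. mat_trace (?X z ^\<^sub>m k)) \<xi> = 0" if "\<xi> \<in> \<Omega>" for \<xi> k
    using lax_at_trace[OF Xk A lax_at_pow[OF X A lax_at_toda_surface(1)]]
      lax_at_trace[OF Xk B lax_at_pow[OF X B lax_at_toda_surface(2)]]
      assms(2,6,7,9) that by (simp_all add: wirt_eq wirt_bar_eq)
  have sq: "su_inner (?X z) (?X z) = - (1/2) * mat_trace (?X z ^\<^sub>m 2)" for z
    using X[of z] by (simp add: su_inner_def numeral_2_eq_2)
  have "su_inner (?X x) (?X x) = su_inner (?X y) (?X y)" if "x \<in> \<Omega>" "y \<in> \<Omega>" for x y
    unfolding sq using constant_if_wirtinger_0[OF assms(2,3) tr that] by simp
  then have const: "\<And>Y Z. Y \<in> ?X ` \<Omega> \<Longrightarrow> Z \<in> ?X ` \<Omega> \<Longrightarrow> su_inner Y Y = su_inner Z Z"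
    by blast
  have sub: "?X ` \<Omega> \<subseteq> su (N+1)"
    using assms(10) by blast
  have n: "N + 1 \<ge> 2"
    using assms(1) by simp
  show ?thesis
    using tr(2,3) by (intro conjI allI impI ballI subset_su_sphere[OF n sub const])
qed

end
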